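(* Let $\underline{x} \leq \overline{x}$ be real numbers, let $\mathcal{X} = \{ x \in \mathbb{R} : \underline{x} \leq x \leq \overline{x} \}$, and let $f_u : \mathbb{R} \rightarrow \mathbb{R}$ be Lipschitz-continuous over $\mathcal{X}$ in the sense that there is a constant $\kappa > 0$ with $$| f_u(x_a) - f_u(x_b) | < \kappa | x_a - x_b | \quad \text{for all } x_a, x_b \in \mathcal{X} \text{ with } x_a \neq x_b .$$ Then for every $\epsilon > 0$ there exists a piecewise-concave function $p : \mathbb{R} \rightarrow \mathbb{R}$ such that $$\max_{x \in \mathcal{X}} | f_u(x) - p(x) | \leq \epsilon .$$
   Context: A function $p : \mathbb{R} \rightarrow \mathbb{R}$ is called piecewise-concave if it is the pointwise maximum of finitely many concave functions, i.e., there exist a positive integer $n_p$ and concave functions $p_1, \ldots, p_{n_p} : \mathbb{R} \rightarrow \mathbb{R}$ such that $p(x) = \max_{i=1,\ldots,n_p} p_i(x)$ for all $x \in \mathbb{R}$. *)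

theory Defs
  imports "HOL-Analysis.Analysis"
begin

definition piecewise_concave :: "(real \<Rightarrow> real) \<Rightarrow> bool" where
  "piecewise_concave p \<longleftrightarrow>
     (\<exists>(n::nat) (q :: nat \<Rightarrow> real \<Rightarrow> real).
        n > 0 \<and>
        (\<forall>i\<in>{1..n}. concave_on UNIV (q i)) \<and>
        (\<forall>x. p x = (MAX i\<in>{1..n}. q i x)))"

text \<open>
  The function \<open>g\<close> attains a maximum over \<open>S\<close>, and its value is \<open>m\<close>.
  A relation is used because \<open>Max\<close> is meaningful only for finite sets, and \<open>Sup\<close> on the reals
  neither expresses attainment nor is meaningful for sets that are unbounded above.
\<close>

definition has_maximum_on :: "('a \<Rightarrow> real) \<Rightarrow> 'a set \<Rightarrow> real \<Rightarrow> bool" where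
  "has_maximum_on g S m \<longleftrightarrow> (\<exists>x\<in>S. g x = m) \<and> (\<forall>x\<in>S. g x \<le> m)"

end

theory Submission
  imports Defs
begin

text \<open>
  A \<open>\<kappa>\<close>-Lipschitz function \<open>f\<close> lies on or above each of the downward cones
  \<open>x \<mapsto> f s - \<kappa> * \<bar>x - s\<bar>\<close> with apex \<open>s\<close> on its graph, and each cone is concave. The pointwise
  maximum of the cones over a finite set \<open>S\<close> of apexes is therefore a piecewise-concave minorant
  of \<open>f\<close>, equal to \<open>f\<close> on \<open>S\<close>. At a point within distance \<open>\<delta>\<close> of \<open>S\<close> it falls short of \<open>f\<close> by at
  most \<open>2 * \<kappa> * \<delta>\<close>: \<open>f\<close> and the cone each move by at most \<open>\<kappa> * \<delta>\<close>
  (\<open>cone_envelope_error\<close>). A compact interval is totally bounded, so it has a finite \<open>\<delta>\<close>-net with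
  \<open>\<delta> = \<epsilon> / (2 * \<kappa>)\<close>. The error attains its maximum because it is continuous on a compact set,
  finite maxima of concave functions on the line being continuous
  (\<open>continuous_on_piecewise_concave\<close>).
\<close>

lemma piecewise_concave_Max:
  assumes "finite S" "S \<noteq> {}" and concave: "\<And>s. s \<in> S \<Longrightarrow> concave_on UNIV (g s)"
  shows "piecewise_concave (\<lambda>x. MAX s\<in>S. g s x)"
proof -
  obtain h where h: "bij_betw h {1..card S} S"
    using ex_bij_betw_nat_finite_1[OF \<open>finite S\<close>] by blast
  have img: "h ` {1..card S} = S"
    using h by (simp add: bij_betw_def)
  have "(MAX s\<in>S. g s x) = (MAX i\<in>{1..card S}. g (h i) x)" for x
    unfolding image_image[of "\<lambda>s. g s x" h, symmetric] img ..
  moreover have "concave_on UNIV (g (h i))" if "i \<in> {1..card S}" for i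
    using that img concave by blast
  moreover have "card S > 0"
    using assms by (simp add: card_gt_0_iff)
  ultimately show ?thesis
    unfolding piecewise_concave_def by (intro exI[of _ "card S"] exI[of _ "\<lambda>i. g (h i)"]) auto
qed

lemma continuous_on_MAX:
  fixes g :: "'i \<Rightarrow> 'a::topological_space \<Rightarrow> 'b::linorder_topology"
  assumes "finite S" "S \<noteq> {}" "\<And>s. s \<in> S \<Longrightarrow> continuous_on A (g s)"
  shows "continuous_on A (\<lambda>x. MAX s\<in>S. g s x)"
  using assms
proof (induction S rule: finite_ne_induct)
  case (insert s S)
  then have "continuous_on A (\<lambda>x. max (g s x) (MAX s\<in>S. g s x))"
    by (intro continuous_on_max) auto
  with insert.hyps show ?case
    by simp
qed simp

text \<open>
  Concavity on the whole line forces continuity, since the line is open and finite-dimensional.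
\<close>

lemma continuous_on_piecewise_concave:
  assumes "piecewise_concave p"
  shows "continuous_on UNIV p"
proof -
  obtain n q where n: "n > 0" and q: "\<forall>i\<in>{1..n::nat}. concave_on UNIV (q i)"
    and p: "\<forall>x. p x = (MAX i\<in>{1..n}. q i x)"
    using assms unfolding piecewise_concave_def by blast
  have "continuous_on UNIV (q i)" if "i \<in> {1..n}" for i
  proof -
    have "continuous_on UNIV (\<lambda>x. - q i x)"
      using q that by (intro convex_on_continuous) (auto simp: concave_on_def)
    from continuous_on_minus[OF this] show ?thesis
      by simp
  qed
  with n have "continuous_on UNIV (\<lambda>x. MAX i\<in>{1..n}. q i x)"
    by (intro continuous_on_MAX) auto
  moreover have "p = (\<lambda>x. MAX i\<in>{1..n}. q i x)"
    using p by blast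
  ultimately show ?thesis
    by simp
qed

lemma concave_on_cone:
  fixes s :: "'a::real_normed_vector"
  assumes "\<kappa> \<ge> 0"
  shows "concave_on UNIV (\<lambda>x. c - \<kappa> * dist s x)"
proof -
  have "convex_on UNIV (\<lambda>x. \<kappa> * dist s x + - c)"
    using assms by (intro convex_on_add convex_on_cmul convex_on_dist) (simp_all add: convex_on_const)
  then show ?thesis
    unfolding concave_on_def by (simp add: algebra_simps)
qed

text \<open>
  The envelope is the classical extension formula of McShane and Whitney for Lipschitz functions,
  with the apexes restricted to a finite subset of the domain. One half of the estimate is that no cone rises
  above \<open>f\<close>; the other half uses only the cone whose apex is near the point considered.
\<close>

lemma cone_envelope_error:
  fixes f :: "'a::metric_space \<Rightarrow> real"
  assumes lip: "\<kappa>-lipschitz_on X f" and S: "finite S" "S \<subseteq> X"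
    and x: "x \<in> X" and s: "s \<in> S" "dist s x \<le> \<delta>"
  shows "\<bar>f x - (MAX s\<in>S. f s - \<kappa> * dist s x)\<bar> \<le> 2 * \<kappa> * \<delta>"
proof -
  let ?p = "MAX s\<in>S. f s - \<kappa> * dist s x"
  have osc: "\<bar>f t - f x\<bar> \<le> \<kappa> * dist t x" if "t \<in> S" for t
    using lipschitz_onD[OF lip, of t x] that S x by (auto simp: dist_real_def)
  have "?p \<le> f x"
  proof (subst Max_le_iff)
    show "\<forall>y\<in>(\<lambda>s. f s - \<kappa> * dist s x) ` S. y \<le> f x"
    proof clarify
      fix t assume "t \<in> S"
      from osc[OF this] show "f t - \<kappa> * dist t x \<le> f x"
        by linarith
    qed
  qed (use S s in auto)
  moreover have "f s - \<kappa> * dist s x \<le> ?p"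
    using S s by (intro Max_ge) auto
  moreover have "\<kappa> * dist s x \<le> \<kappa> * \<delta>"
    using s lipschitz_on_nonneg[OF lip] by (intro mult_left_mono)
  ultimately show ?thesis
    using osc[OF \<open>s \<in> S\<close>] by linarith
qed

theorem theorem2:
  fixes xl xu :: real and f :: "real \<Rightarrow> real" and \<epsilon> :: real
  assumes "xl \<le> xu"
    and "\<exists>\<kappa>>0. \<forall>xa\<in>{xl..xu}. \<forall>xb\<in>{xl..xu}. xa \<noteq> xb \<longrightarrow> \<bar>f xa - f xb\<bar> < \<kappa> * \<bar>xa - xb\<bar>"
    and "\<epsilon> > 0"
  shows "\<exists>p. piecewise_concave p \<and>
           (\<exists>m. has_maximum_on (\<lambda>x. \<bar>f x - p x\<bar>) {xl..xu} m \<and> m \<le> \<epsilon>)"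
proof -
  let ?X = "{xl..xu}"
  obtain \<kappa> where "\<kappa> > 0"
    and \<kappa>: "\<And>a b. a \<in> ?X \<Longrightarrow> b \<in> ?X \<Longrightarrow> a \<noteq> b \<Longrightarrow> \<bar>f a - f b\<bar> < \<kappa> * \<bar>a - b\<bar>"
    using assms(2) by blast
  have lip: "\<kappa>-lipschitz_on ?X f"
  proof (rule lipschitz_onI)
    show "dist (f a) (f b) \<le> \<kappa> * dist a b" if "a \<in> ?X" "b \<in> ?X" for a b
      using \<kappa>[OF that] by (cases "a = b") (auto simp: dist_real_def)
  qed (use \<open>\<kappa> > 0\<close> in simp)
  define \<delta> where "\<delta> = \<epsilon> / (2 * \<kappa>)"
  have "\<delta> > 0"
    using \<open>\<epsilon> > 0\<close> \<open>\<kappa> > 0\<close> by (simp add: \<delta>_def)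
  moreover have "\<forall>e>0. \<exists>S. finite S \<and> S \<subseteq> ?X \<and> ?X \<subseteq> (\<Union>s\<in>S. ball s e)"
    by (intro seq_compact_imp_totally_bounded compact_imp_seq_compact compact_Icc)
  ultimately obtain S where S: "finite S" "S \<subseteq> ?X" and net: "?X \<subseteq> (\<Union>s\<in>S. ball s \<delta>)"
    by metis
  have "S \<noteq> {}"
    using net \<open>xl \<le> xu\<close> by auto
  define p where "p x = (MAX s\<in>S. f s - \<kappa> * dist s x)" for x
  have p: "piecewise_concave p"
    unfolding p_def using S \<open>S \<noteq> {}\<close> \<open>\<kappa> > 0\<close>
    by (intro piecewise_concave_Max concave_on_cone) auto
  have error: "\<bar>f x - p x\<bar> \<le> \<epsilon>" if "x \<in> ?X" for x
  proof -
    obtain s where "s \<in> S" "dist s x \<le> \<delta>"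
      using subsetD[OF net \<open>x \<in> ?X\<close>] by (auto intro: less_imp_le)
    from cone_envelope_error[OF lip S that this] show ?thesis
      using \<open>\<kappa> > 0\<close> by (simp add: p_def \<delta>_def)
  qed
  have "continuous_on ?X (\<lambda>x. \<bar>f x - p x\<bar>)"
    using lipschitz_on_continuous_on[OF lip] continuous_on_piecewise_concave[OF p]
    by (intro continuous_intros) (auto intro: continuous_on_subset)
  then obtain z where "z \<in> ?X" "\<forall>x\<in>?X. \<bar>f x - p x\<bar> \<le> \<bar>f z - p z\<bar>"
    using continuous_attains_sup[of ?X "\<lambda>x. \<bar>f x - p x\<bar>"] \<open>xl \<le> xu\<close> by auto
  then have "has_maximum_on (\<lambda>x. \<bar>f x - p x\<bar>) ?X \<bar>f z - p z\<bar>"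
    unfolding has_maximum_on_def by blast
  with p error[OF \<open>z \<in> ?X\<close>] show ?thesis
    by blast
qed

end
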